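(* Let $E$ be a set and let $r:2^E\times 2^E\rightarrow \mathbb{N}\cup\{\infty\}$ be a partial function, with value $r(A|B)$ defined for the pairs $(A,B)$ with $B\subseteq A\subseteq E$. Put $\mathcal{I}_r:=\{I\subseteq E\mid r(I|I\setminus\{x\})>0\text{ for all }x\in I\}$. Suppose that: (R1) $0\leq r(A|B)\leq |A\setminus B|$ for all $B\subseteq A\subseteq E$; (R2) $r(A|A\cap B)\geq r(A\cup B|B)$ for all $A,B\subseteq E$; (R3) $r(A|C)=r(A|B)+r(B|C)$ for all $C\subseteq B\subseteq A\subseteq E$; (R4) for all $B\subseteq A\subseteq E$ and every family $(A_\gamma)_{\gamma\in\Gamma}$ of sets with $B\subseteq A_\gamma$ for all $\gamma\in\Gamma$: if $A=\bigcup_{\gamma\in\Gamma}A_\gamma$ and $r(A_\gamma|B)=0$ for all $\gamma\in\Gamma$, then $r(A|B)=0$; (R5) for all $B\subseteq A\subseteq E$ there exists $I\in\mathcal{I}_r$ with $I\subseteq A$ such that $r(A|I)=0$ and $r(B|B\cap I)=0$. Then $M=(E,\mathcal{I}_r)$ is an infinite matroid, and $r=r_M$, that is, $r(A|B)=r_M(A|B)$ for all $B\subseteq A\subseteq E$, where $r_M$ is the relative rank function of $M$.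
   Context: Sets may be finite or infinite. $|X|\in\mathbb{N}\cup\{\infty\}$ denotes the number of elements of $X$ (with $|X|=\infty$ for every infinite $X$), with the usual order and addition on $\mathbb{N}\cup\{\infty\}$ ($0\in\mathbb{N}$). An infinite matroid is a pair $M=(E,\mathcal{I})$ where $E$ is any set and $\mathcal{I}$ is a set of subsets of $E$ (the independent sets) such that, with $\mathcal{I}^{\max}$ the set of inclusionwise maximal elements of $\mathcal{I}$: (I1) $\emptyset\in\mathcal{I}$; (I2) $\mathcal{I}$ is closed under taking subsets; (I3) if $I\in\mathcal{I}\setminus\mathcal{I}^{\max}$ and $I'\in\mathcal{I}^{\max}$, then $I\cup\{x\}\in\mathcal{I}$ for some $x\in I'\setminus I$; (IM) if $I\subseteq X\subseteq E$ and $I\in\mathcal{I}$, then the set $\{I'\in\mathcal{I}\mid I\subseteq I'\subseteq X\}$ has an inclusionwise maximal element. The relative rank function of $M$ is defined for $B\subseteq A\subseteq E$ by $$r_M(A|B):=\max\{|I\setminus J| \;\mid\; J\subseteq I\subseteq A,\ I\in\mathcal{I},\ J\text{ an inclusionwise maximal independent subset of }B\}.$$ *)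

theory Defs
  imports Main "HOL-Library.Extended_Nat"
begin

definition ecard :: "'a set \<Rightarrow> enat" where
  "ecard X = (if finite X then enat (card X) else \<infinity>)"

definition maximal_members :: "'a set set \<Rightarrow> 'a set set" where
  "maximal_members S = {X \<in> S. \<forall>Y \<in> S. X \<subseteq> Y \<longrightarrow> Y = X}"

locale infinite_matroid =
  fixes E :: "'a set" and \<I> :: "'a set set"
  assumes indep_subset_ground: "\<And>I. I \<in> \<I> \<Longrightarrow> I \<subseteq> E"
    and I1: "{} \<in> \<I>"
    and I2: "\<And>I I'. I \<in> \<I> \<Longrightarrow> I' \<subseteq> I \<Longrightarrow> I' \<in> \<I>"
    and I3: "\<And>I I'. I \<in> \<I> - maximal_members \<I> \<Longrightarrow> I' \<in> maximal_members \<I> \<Longrightarrow>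
               \<exists>x \<in> I' - I. I \<union> {x} \<in> \<I>"
    and IM: "\<And>I X. I \<subseteq> X \<Longrightarrow> X \<subseteq> E \<Longrightarrow> I \<in> \<I> \<Longrightarrow>
               \<exists>I'. I' \<in> maximal_members {I' \<in> \<I>. I \<subseteq> I' \<and> I' \<subseteq> X}"

definition rel_rank_values :: "'a set set \<Rightarrow> 'a set \<Rightarrow> 'a set \<Rightarrow> enat set" where
  "rel_rank_values \<I> A B =
     {ecard (I - J) | I J. J \<subseteq> I \<and> I \<subseteq> A \<and> I \<in> \<I> \<and> J \<in> maximal_members {J \<in> \<I>. J \<subseteq> B}}"

text \<open>The following is a genuine maximum, not a supremum: it is unspecified if the set of values
  has no largest element.\<close>

definition rel_rank :: "'a set set \<Rightarrow> 'a set \<Rightarrow> 'a set \<Rightarrow> enat" where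
  "rel_rank \<I> A B = (GREATEST n. n \<in> rel_rank_values \<I> A B)"

text \<open>A partial function \<open>r(A|B)\<close>, defined for \<open>B \<subseteq> A \<subseteq> E\<close>, is represented by a total function
  \<open>r A B\<close> that is only ever evaluated at such pairs.\<close>

definition indep_of_rank :: "'a set \<Rightarrow> ('a set \<Rightarrow> 'a set \<Rightarrow> enat) \<Rightarrow> 'a set set" where
  "indep_of_rank E r = {I. I \<subseteq> E \<and> (\<forall>x \<in> I. r I (I - {x}) > 0)}"

end

theory Submission
  imports Defs
begin

text \<open>A set \<open>I\<close> is independent iff no \<open>x \<in> I\<close> is spanned by \<open>I - {x}\<close>, where \<open>C \<subseteq> A\<close> spans \<open>A\<close>
  if \<open>r A C = 0\<close>. Counting ranks shows that adding an unspanned point keeps a set independent, so by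
  (R4) the maximal independent subsets of \<open>X\<close> are exactly the independent spanning ones; this gives
  (I3). An independent \<open>B\<close> has no proper spanning subset, so the set provided by (R5) for
  \<open>B \<subseteq> A\<close> extends \<open>B\<close>, which is (IM). Finally \<open>r I J = |I - J|\<close> for independent \<open>I \<supseteq> J\<close>, and
  \<open>r A B = r A J\<close> when \<open>J\<close> spans \<open>B\<close>; hence \<open>r A B\<close> bounds every value in the definition of the
  relative rank, and the set from (R5) attains it.\<close>

section \<open>Cardinalities in \<open>enat\<close>\<close>

lemma ecard_empty [simp]: "ecard {} = 0"
  by (simp add: ecard_def zero_enat_def)

lemma ecard_insert: "x \<notin> X \<Longrightarrow> ecard (insert x X) = ecard X + 1"
  by (auto simp: ecard_def one_enat_def)

lemma ecard_singleton [simp]: "ecard {x} = 1"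
  by (simp add: ecard_def one_enat_def)

lemma enat_one_le_iff: "1 \<le> (n::enat) \<longleftrightarrow> n \<noteq> 0"
  by (cases n) (auto simp: one_enat_def zero_enat_def)

text \<open>An infinite \<open>X\<close> has finite subsets of every size, which forces
  \<open>m\<close> to be \<infinity>. This reduces lower bounds on ranks to finite sets.\<close>

lemma ecard_leI:
  assumes "\<And>F. finite F \<Longrightarrow> F \<subseteq> X \<Longrightarrow> ecard F \<le> m"
  shows "ecard X \<le> m"
proof (cases "finite X")
  case False
  have "enat n \<le> m" for n
  proof -
    obtain F where "finite F" "F \<subseteq> X" "card F = n"
      using infinite_arbitrarily_large [OF False] by blast
    then show ?thesis using assms [of F] by (simp add: ecard_def)
  qed
  then have bound: "enat n \<le> m" for n .
  show ?thesis
  proof (cases m)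
    case (enat k)
    then show ?thesis using bound [of "Suc k"] by simp
  qed simp
qed (use assms in auto)

locale relative_rank_function =
  fixes E :: "'a set" and r :: "'a set \<Rightarrow> 'a set \<Rightarrow> enat"
  assumes R1: "\<And>A B. B \<subseteq> A \<Longrightarrow> A \<subseteq> E \<Longrightarrow> r A B \<le> ecard (A - B)"
    and R2: "\<And>A B. A \<subseteq> E \<Longrightarrow> B \<subseteq> E \<Longrightarrow> r (A \<union> B) B \<le> r A (A \<inter> B)"
    and R3: "\<And>A B C. C \<subseteq> B \<Longrightarrow> B \<subseteq> A \<Longrightarrow> A \<subseteq> E \<Longrightarrow> r A C = r A B + r B C"
    and R4: "\<And>A B \<A>. B \<subseteq> A \<Longrightarrow> A \<subseteq> E \<Longrightarrow> (\<And>A'. A' \<in> \<A> \<Longrightarrow> B \<subseteq> A') \<Longrightarrow>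
               A = \<Union>\<A> \<Longrightarrow> (\<And>A'. A' \<in> \<A> \<Longrightarrow> r A' B = 0) \<Longrightarrow> r A B = 0"
    and R5: "\<And>A B. B \<subseteq> A \<Longrightarrow> A \<subseteq> E \<Longrightarrow>
               \<exists>I \<in> indep_of_rank E r. I \<subseteq> A \<and> r A I = 0 \<and> r B (B \<inter> I) = 0"
begin

abbreviation \<I> :: "'a set set" where
  "\<I> \<equiv> indep_of_rank E r"

section \<open>Elementary rank inequalities\<close>

lemma rank_self: "A \<subseteq> E \<Longrightarrow> r A A = 0"
  using R1 [of A A] by simp

lemma rank_mono_left: "C \<subseteq> B \<Longrightarrow> B \<subseteq> A \<Longrightarrow> A \<subseteq> E \<Longrightarrow> r B C \<le> r A C"
  using R3 [of C B A] by simp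

lemma rank_antimono_right: "C \<subseteq> B \<Longrightarrow> B \<subseteq> A \<Longrightarrow> A \<subseteq> E \<Longrightarrow> r A B \<le> r A C"
  using R3 [of C B A] by simp

lemma rank_insert_le:
  assumes "insert x B \<subseteq> E"
  shows "r (insert x B) B \<le> 1"
proof (cases "x \<in> B")
  case True
  then show ?thesis using assms rank_self by (simp add: insert_absorb)
next
  case False
  then show ?thesis using R1 [of B "insert x B"] assms by (auto simp: insert_Diff_if)
qed

text \<open>\<open>R2\<close> applies with \<open>B \<union> X\<close> as second set; its meet with
  \<open>A\<close> contains \<open>B\<close>, so enlarging \<open>B\<close> to that meet only lowers
  the rank. In particular, spanning survives adding \<open>X\<close> to both sides.\<close>

lemma rank_Un_le:
  assumes "B \<subseteq> A" "A \<subseteq> E" "X \<subseteq> E"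
  shows "r (A \<union> X) (B \<union> X) \<le> r A B"
proof -
  have "A \<union> (B \<union> X) = A \<union> X" using assms by blast
  then have "r (A \<union> X) (B \<union> X) \<le> r A (A \<inter> (B \<union> X))"
    using R2 [of A "B \<union> X"] assms by auto
  also have "\<dots> \<le> r A B" using assms by (intro rank_antimono_right) auto
  finally show ?thesis .
qed

text \<open>By \<open>R4\<close>, spanning can be tested one point at a time.\<close>

lemma rank_eq_0I:
  assumes "B \<subseteq> A" "A \<subseteq> E" "\<And>x. x \<in> A - B \<Longrightarrow> r (insert x B) B = 0"
  shows "r A B = 0"
\<comment> \<open>\<open>B\<close> itself belongs to the family so that the union is still
  \<open>A\<close> when \<open>A = B\<close>.\<close>
proof (rule R4 [of B A "insert B ((\<lambda>x. insert x B) ` (A - B))"])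
  show "A = \<Union> (insert B ((\<lambda>x. insert x B) ` (A - B)))" using assms(1) by auto
  show "r A' B = 0" if "A' \<in> insert B ((\<lambda>x. insert x B) ` (A - B))" for A'
    using that assms rank_self [of B] by auto
qed (use assms in auto)

section \<open>Independence, spanning and maximality\<close>

lemma indep_iff: "I \<in> \<I> \<longleftrightarrow> I \<subseteq> E \<and> (\<forall>x \<in> I. r I (I - {x}) \<noteq> 0)"
  by (auto simp: indep_of_rank_def)

text \<open>If \<open>J - {x}\<close> spanned \<open>J\<close>, adding \<open>I - {x}\<close> on
  both sides would make \<open>I - {x}\<close> span \<open>I\<close>.\<close>

lemma indep_subset:
  assumes "I \<in> \<I>" "J \<subseteq> I"
  shows "J \<in> \<I>"
proof -
  have "r J (J - {x}) \<noteq> 0" if x: "x \<in> J" for x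
  proof
    assume "r J (J - {x}) = 0"
    moreover have "J \<union> (I - {x}) = I" "J - {x} \<union> (I - {x}) = I - {x}" using assms x by auto
    ultimately have "r I (I - {x}) = 0"
      using rank_Un_le [of "J - {x}" J "I - {x}"] assms by (auto simp: indep_iff)
    then show False using assms x by (auto simp: indep_iff)
  qed
  then show ?thesis using assms by (auto simp: indep_iff)
qed

text \<open>If \<open>insert x I - {y}\<close> spanned \<open>insert x I\<close>, the rank of
  \<open>insert x I\<close> over \<open>I - {y}\<close> could be counted in two ways: through
  \<open>I\<close> it is at least \<open>1 + 1\<close>, through \<open>insert x (I - {y})\<close> at
  most \<open>0 + 1\<close>.\<close>

lemma indep_insertI:
  assumes I: "I \<in> \<I>" and x: "x \<in> E" and nz: "r (insert x I) I \<noteq> 0"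
  shows "insert x I \<in> \<I>"
proof -
  have IE: "insert x I \<subseteq> E" using I x by (simp add: indep_iff)
  have xI: "x \<notin> I" using nz rank_self IE by (auto simp: insert_absorb)
  have "r (insert x I) (insert x I - {y}) \<noteq> 0" if y: "y \<in> I" for y
  proof
    assume 0: "r (insert x I) (insert x I - {y}) = 0"
    have eq: "insert x I - {y} = insert x (I - {y})" using xI y by auto
    have "r (insert x I) I + r I (I - {y}) = r (insert x I) (I - {y})"
      using R3 [of "I - {y}" I "insert x I"] IE by (simp add: subset_insertI)
    also have "\<dots> = r (insert x (I - {y})) (I - {y})"
      using R3 [of "I - {y}" "insert x (I - {y})" "insert x I"] 0 eq IE by auto
    also have "\<dots> \<le> 1" using IE by (intro rank_insert_le) auto
    finally have "r (insert x I) I + r I (I - {y}) \<le> 1" .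
    moreover have "1 \<le> r (insert x I) I" "1 \<le> r I (I - {y})"
      using nz I y by (simp_all add: indep_iff enat_one_le_iff)
    then have "1 + 1 \<le> r (insert x I) I + r I (I - {y})" by (rule add_mono)
    ultimately have "(1 + 1 :: enat) \<le> 1" by (rule order_trans [rotated])
    then show False by (simp add: one_enat_def)
  qed
  then show ?thesis using IE nz xI by (auto simp: indep_iff)
qed

text \<open>A point \<open>x\<close> of \<open>I\<close> missing from \<open>J\<close> puts
  \<open>J\<close> inside \<open>I - {x}\<close>, which would then span \<open>I\<close>
  too.\<close>

lemma indep_no_proper_spanning:
  assumes "I \<in> \<I>" "J \<subseteq> I" "r I J = 0"
  shows "J = I"
proof (rule ccontr)
  assume "J \<noteq> I"
  then obtain x where x: "x \<in> I" "x \<notin> J" using assms by blast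
  then have "r I (I - {x}) \<le> r I J"
    using assms by (intro rank_antimono_right) (auto simp: indep_iff)
  then show False using assms x by (auto simp: indep_iff)
qed

text \<open>If \<open>I\<close> is maximal, no point of \<open>X\<close> can be added, so each is
  spanned and hence all of \<open>X\<close> is. Conversely, a spanning \<open>I\<close> also spans
  every independent \<open>K\<close> between \<open>I\<close> and \<open>X\<close>, so
  \<open>K = I\<close>.\<close>

lemma maximal_indep_iff:
  assumes "I \<in> \<I>" "I \<subseteq> X" "X \<subseteq> E"
  shows "(\<forall>K \<in> \<I>. I \<subseteq> K \<and> K \<subseteq> X \<longrightarrow> K = I) \<longleftrightarrow> r X I = 0"
proof
  assume max: "\<forall>K \<in> \<I>. I \<subseteq> K \<and> K \<subseteq> X \<longrightarrow> K = I"
  have "r (insert x I) I = 0" if "x \<in> X - I" for x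
  proof (rule ccontr)
    assume "r (insert x I) I \<noteq> 0"
    then have "insert x I \<in> \<I>" using assms that by (intro indep_insertI) auto
    then have "insert x I = I" using assms that by (intro max [rule_format]) auto
    then show False using that by auto
  qed
  then show "r X I = 0" using assms rank_eq_0I by blast
next
  assume 0: "r X I = 0"
  show "\<forall>K \<in> \<I>. I \<subseteq> K \<and> K \<subseteq> X \<longrightarrow> K = I"
  proof (intro ballI impI)
    fix K assume K: "K \<in> \<I>" "I \<subseteq> K \<and> K \<subseteq> X"
    then have "r K I \<le> r X I" using assms by (intro rank_mono_left) auto
    then have "r K I = 0" using 0 by simp
    then have "I = K" using indep_no_proper_spanning K by blast
    then show "K = I" ..
  qed
qed

lemma maximal_members_indep_iff:
  assumes "X \<subseteq> E"
  shows "J \<in> maximal_members {J \<in> \<I>. J \<subseteq> X} \<longleftrightarrow> J \<in> \<I> \<and> J \<subseteq> X \<and> r X J = 0"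
  using maximal_indep_iff [of J X] assms by (auto simp: maximal_members_def)

lemma bases_iff: "I \<in> maximal_members \<I> \<longleftrightarrow> I \<in> \<I> \<and> r E I = 0"
proof -
  have "{J \<in> \<I>. J \<subseteq> E} = \<I>" by (auto simp: indep_iff)
  then show ?thesis using maximal_members_indep_iff [of E I] by (auto simp: indep_iff)
qed

section \<open>The matroid axioms\<close>

lemma infinite_matroid_indep: "infinite_matroid E \<I>"
proof
  show "I \<subseteq> E" if "I \<in> \<I>" for I using that by (simp add: indep_iff)
  show "{} \<in> \<I>" by (simp add: indep_iff)
  show "I' \<in> \<I>" if "I \<in> \<I>" "I' \<subseteq> I" for I I' using indep_subset that .
  show "\<exists>x \<in> I' - I. I \<union> {x} \<in> \<I>"
    if I: "I \<in> \<I> - maximal_members \<I>" and I': "I' \<in> maximal_members \<I>" for I I'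
  proof (rule ccontr)
    assume no: "\<not> ?thesis"
    have IE: "I \<subseteq> E" "I' \<subseteq> E" using I I' by (auto simp: bases_iff indep_iff)
    \<comment> \<open>A point of \<open>I'\<close> that cannot be added to \<open>I\<close> is
      spanned by \<open>I\<close>. So \<open>I\<close> spans \<open>I \<union> I'\<close>, which
      spans \<open>E\<close> because \<open>I'\<close> does, and \<open>I\<close> would be a maximal
      independent set.\<close>
    have "r (insert x I) I = 0" if "x \<in> I \<union> I' - I" for x
      using indep_insertI [of I x] no I IE that by auto
    then have "r (I \<union> I') I = 0" using IE rank_eq_0I [of I "I \<union> I'"] by blast
    moreover have "r E (I \<union> I') = 0"
      using rank_antimono_right [of I' "I \<union> I'" E] I' IE by (auto simp: bases_iff)
    ultimately have "r E I = 0" using R3 [of I "I \<union> I'" E] IE by auto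
    then show False using I by (simp add: bases_iff)
  qed
  show "\<exists>I'. I' \<in> maximal_members {I' \<in> \<I>. I \<subseteq> I' \<and> I' \<subseteq> X}"
    if I: "I \<subseteq> X" "X \<subseteq> E" "I \<in> \<I>" for I X
  proof -
    \<comment> \<open>\<open>R5\<close> is used with \<open>I\<close> as the smaller set:
      \<open>J\<close> spans \<open>X\<close>, and \<open>I \<inter> J\<close> spans the independent
      \<open>I\<close>, hence equals it.\<close>
    obtain J where J: "J \<in> \<I>" "J \<subseteq> X" "r X J = 0" "r I (I \<inter> J) = 0"
      using R5 [of I X] I by blast
    then have "I \<subseteq> J" using indep_no_proper_spanning [of I "I \<inter> J"] I by auto
    then show ?thesis
      using maximal_indep_iff [of J X] J I by (auto simp: maximal_members_def)
  qed
qed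

section \<open>Ranks of independent sets and the relative rank\<close>

text \<open>Each new point contributes exactly 1: at least 1 by independence, at most 1 by
  \<open>R1\<close>. The set \<open>J\<close> may be infinite.\<close>

lemma rank_finite_extension:
  assumes "finite F" "J \<inter> F = {}" "J \<union> F \<in> \<I>"
  shows "r (J \<union> F) J = ecard F"
  using assms
proof (induction F)
  case empty
  then show ?case using rank_self by (simp add: indep_iff)
next
  case (insert x F)
  let ?K = "J \<union> F"
  have K: "insert x ?K \<in> \<I>" "x \<notin> ?K" using insert by auto
  then have "?K \<in> \<I>" using indep_subset by blast
  then have IH: "r ?K J = ecard F" using insert by auto
  have "r (insert x ?K) ?K \<noteq> 0" using K by (auto simp: indep_iff insert_Diff_if)
  then have "1 \<le> r (insert x ?K) ?K" by (simp add: enat_one_le_iff)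
  moreover have "r (insert x ?K) ?K \<le> 1" using K by (intro rank_insert_le) (simp add: indep_iff)
  ultimately have "r (insert x ?K) ?K = 1" by simp
  then have "r (insert x ?K) J = 1 + ecard F"
    using R3 [of J ?K "insert x ?K"] IH K by (auto simp: indep_iff)
  then show ?case using insert by (simp add: ecard_insert add.commute)
qed

text \<open>\<open>R1\<close> gives the upper bound. The lower bound comes from the finite subsets
  of \<open>I - J\<close>, which also settles the infinite case.\<close>

lemma rank_indep:
  assumes "I \<in> \<I>" "J \<subseteq> I"
  shows "r I J = ecard (I - J)"
proof (rule antisym)
  show "r I J \<le> ecard (I - J)" using assms R1 by (simp add: indep_iff)
  show "ecard (I - J) \<le> r I J"
  proof (rule ecard_leI)
    fix F assume F: "finite F" "F \<subseteq> I - J"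
    then have "J \<union> F \<in> \<I>" using indep_subset [of I "J \<union> F"] assms by auto
    then have "r (J \<union> F) J = ecard F" using F by (intro rank_finite_extension) auto
    then show "ecard F \<le> r I J"
      using rank_mono_left [of J "J \<union> F" I] F assms by (auto simp: indep_iff)
  qed
qed

lemma rank_spanning_right:
  assumes "J \<subseteq> B" "B \<subseteq> A" "A \<subseteq> E" "r B J = 0"
  shows "r A J = r A B"
  using R3 [of J B A] assms by simp

text \<open>For the set \<open>I\<close> of \<open>R5\<close>, the trace \<open>B \<inter> I\<close>
  spans \<open>B\<close> and so is a legitimate choice of \<open>J\<close>; as \<open>I\<close>
  spans \<open>A\<close>, no rank is lost in passing from \<open>A\<close> to
  \<open>I\<close>.\<close>

lemma rank_in_rel_rank_values:
  assumes "B \<subseteq> A" "A \<subseteq> E"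
  shows "r A B \<in> rel_rank_values \<I> A B"
proof -
  obtain I where I: "I \<in> \<I>" "I \<subseteq> A" "r A I = 0" "r B (B \<inter> I) = 0"
    using R5 [OF assms] by blast
  have "B \<inter> I \<in> maximal_members {J \<in> \<I>. J \<subseteq> B}"
  proof -
    have "B \<inter> I \<in> \<I>" using indep_subset [OF I(1)] by simp
    moreover have "B \<subseteq> E" using assms by simp
    ultimately show ?thesis using I(4) by (simp only: maximal_members_indep_iff) simp
  qed
  moreover have "r A B = ecard (I - B \<inter> I)"
  proof -
    have "r A B = r A (B \<inter> I)" using I assms by (intro rank_spanning_right [symmetric]) auto
    also have "\<dots> = r A I + r I (B \<inter> I)" using I assms by (intro R3) auto
    also have "\<dots> = ecard (I - B \<inter> I)" using I by (simp add: rank_indep)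
    finally show ?thesis .
  qed
  ultimately show ?thesis
    using I(1,2) unfolding rel_rank_values_def mem_Collect_eq
    by (intro exI [of _ I] exI [of _ "B \<inter> I"]) simp
qed

text \<open>Since \<open>J\<close> spans \<open>B\<close>, ranks over \<open>B\<close> and over
  \<open>J\<close> agree, and \<open>ecard (I - J)\<close> is \<open>r I J\<close>, which grows with
  the left argument.\<close>

lemma rel_rank_values_le_rank:
  assumes "B \<subseteq> A" "A \<subseteq> E" "n \<in> rel_rank_values \<I> A B"
  shows "n \<le> r A B"
proof -
  obtain I J where n: "n = ecard (I - J)" and I: "J \<subseteq> I" "I \<subseteq> A" "I \<in> \<I>"
    and J: "J \<in> maximal_members {J \<in> \<I>. J \<subseteq> B}"
    using assms by (auto simp: rel_rank_values_def)
  have "J \<subseteq> B" "r B J = 0" using J assms by (auto simp: maximal_members_indep_iff)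
  then have "r A J = r A B" using assms by (intro rank_spanning_right)
  moreover have "n = r I J" using n I by (simp add: rank_indep)
  ultimately show ?thesis using rank_mono_left [of J I A] I assms by simp
qed

lemma rank_eq_rel_rank: "B \<subseteq> A \<Longrightarrow> A \<subseteq> E \<Longrightarrow> r A B = rel_rank \<I> A B"
  unfolding rel_rank_def
  by (rule Greatest_equality [symmetric]) (auto intro: rank_in_rel_rank_values rel_rank_values_le_rank)

end

theorem theorem3p1:
  fixes E :: "'a set" and r :: "'a set \<Rightarrow> 'a set \<Rightarrow> enat"
  assumes R1: "\<And>A B. B \<subseteq> A \<Longrightarrow> A \<subseteq> E \<Longrightarrow> 0 \<le> r A B \<and> r A B \<le> ecard (A - B)"
    and R2: "\<And>A B. A \<subseteq> E \<Longrightarrow> B \<subseteq> E \<Longrightarrow> r A (A \<inter> B) \<ge> r (A \<union> B) B"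
    and R3: "\<And>A B C. C \<subseteq> B \<Longrightarrow> B \<subseteq> A \<Longrightarrow> A \<subseteq> E \<Longrightarrow> r A C = r A B + r B C"
    and R4: "\<And>A B \<A>. B \<subseteq> A \<Longrightarrow> A \<subseteq> E \<Longrightarrow> (\<And>A'. A' \<in> \<A> \<Longrightarrow> B \<subseteq> A') \<Longrightarrow>
               A = \<Union>\<A> \<Longrightarrow> (\<And>A'. A' \<in> \<A> \<Longrightarrow> r A' B = 0) \<Longrightarrow> r A B = 0"
    and R5: "\<And>A B. B \<subseteq> A \<Longrightarrow> A \<subseteq> E \<Longrightarrow>
               \<exists>I \<in> indep_of_rank E r. I \<subseteq> A \<and> r A I = 0 \<and> r B (B \<inter> I) = 0"
  shows "infinite_matroid E (indep_of_rank E r) \<and>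
         (\<forall>A B. B \<subseteq> A \<and> A \<subseteq> E \<longrightarrow>
            (\<exists>m \<in> rel_rank_values (indep_of_rank E r) A B.
               \<forall>n \<in> rel_rank_values (indep_of_rank E r) A B. n \<le> m) \<and>
            r A B = rel_rank (indep_of_rank E r) A B)"
proof -
  have "relative_rank_function E r"
  proof
    show "r A B \<le> ecard (A - B)" if "B \<subseteq> A" "A \<subseteq> E" for A B
      using R1 [OF that] ..
  qed (fact R2 R3 R4 R5)+
  then interpret relative_rank_function E r .
  show ?thesis
  proof (intro conjI allI impI; (elim conjE)?)
    show "infinite_matroid E (indep_of_rank E r)" by (rule infinite_matroid_indep)
    fix A B assume AB: "B \<subseteq> A" "A \<subseteq> E"
    \<comment> \<open>The maximum is \<open>r A B\<close> itself, so \<open>GREATEST\<close> in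
      \<open>rel_rank\<close> is well defined here.\<close>
    show "\<exists>m \<in> rel_rank_values (indep_of_rank E r) A B.
            \<forall>n \<in> rel_rank_values (indep_of_rank E r) A B. n \<le> m"
      using rank_in_rel_rank_values [OF AB] rel_rank_values_le_rank [OF AB] by (intro bexI ballI)
    show "r A B = rel_rank (indep_of_rank E r) A B" using AB by (rule rank_eq_rel_rank)
  qed
qed

end
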